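(* Let $\Phi$ be a point process on $\mathbb{R}^2$ with timers and contention variables, and suppose the conflict graph $G(\Phi,C)$ has (almost surely) no infinite positive percolation. Then, almost surely, for all $x\in\Phi$, $$e_\infty(x)=\lim_{k\to\infty}e_k(x).$$
   Context: Each point $x$ of $\Phi$ carries a timer $t(x)\in[0,1]$ (timers are i.i.d. uniform), and each unordered pair of distinct points $x,y\in\Phi$ carries a Boolean variable $C(x,y)=C(y,x)\in\{0,1\}$. The conflict graph $G(\Phi,C)$ is the directed graph with vertex set $\Phi$ and an edge from $x$ to $y$ iff $C(x,y)=1$ and $t(y)<t(x)$. A directed acyclic graph has no infinite positive percolation if, for every vertex $x$, the set of vertices reachable from $x$ by a directed path (including $x$) is finite. Thinning indicators (empty products equal $1$): $e_0(x)=1$ and for $k\ge1$, $e_k(x)=\prod_{y\in\Phi,\ t(y)<t(x)}(1-e_{k-1}(y)C(x,y))$. When the conflict graph has no infinite positive percolation, $e_\infty:\Phi\to\{0,1\}$ is the unique solution of $e_\infty(x)=\prod_{y\in\Phi,\ t(y)<t(x)}(1-e_\infty(y)C(x,y))$ for all $x\in\Phi$. *)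

theory Defs
  imports
    "HOL-Probability.Probability"
    "HOL-Library.Extended_Nat"
    "Graph_Theory.Pair_Digraph"
begin

section \<open>Unordered products over possibly infinite sets\<close>

text \<open>
  The constant \<^const>\<open>prod\<close> is 1 on every infinite index set, so it cannot be used here: the
  products below range over sets of points that are infinite in general.  As for
  \<^const>\<open>infsum\<close>, the value is the limit along the net of finite subproducts.
\<close>

definition uprod :: "('a \<Rightarrow> real) \<Rightarrow> 'a set \<Rightarrow> real" where
  "uprod f A = Lim (finite_subsets_at_top A) (prod f)"

lemma uprod_zero_one:
  assumes "\<And>y. y \<in> A \<Longrightarrow> f y \<in> {0, 1}"
  shows "uprod f A = of_bool (\<forall>y\<in>A. f y = 1)"
proof -
  have "\<forall>\<^sub>F F in finite_subsets_at_top A. prod f F = of_bool (\<forall>y\<in>A. f y = 1)"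
  proof (cases "\<forall>y\<in>A. f y = 1")
    case True
    then show ?thesis
      by (intro eventually_finite_subsets_at_top_weakI) (auto intro!: prod.neutral)
  next
    case False
    then obtain y where "y \<in> A" "f y = 0" using assms by blast
    then show ?thesis
      unfolding eventually_finite_subsets_at_top using False
      by (intro exI[of _ "{y}"]) auto
  qed
  then show ?thesis
    unfolding uprod_def by (intro tendsto_Lim tendsto_eventually) auto
qed


section \<open>Conflict graph and thinning indicators of a configuration\<close>

definition conflict_graph ::
    "'a set \<Rightarrow> ('a \<Rightarrow> real) \<Rightarrow> ('a \<Rightarrow> 'a \<Rightarrow> bool) \<Rightarrow> 'a pair_pre_digraph" where
  "conflict_graph P t C =
     \<lparr> pverts = P, parcs = {(x, y). x \<in> P \<and> y \<in> P \<and> C x y \<and> t y < t x} \<rparr>"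

definition no_infinite_positive_percolation :: "('a, 'b) pre_digraph \<Rightarrow> bool" where
  "no_infinite_positive_percolation G \<longleftrightarrow> (\<forall>x \<in> verts G. finite {y. x \<rightarrow>\<^sup>*\<^bsub>G\<^esub> y})"

primrec thinning ::
    "'a set \<Rightarrow> ('a \<Rightarrow> real) \<Rightarrow> ('a \<Rightarrow> 'a \<Rightarrow> bool) \<Rightarrow> nat \<Rightarrow> 'a \<Rightarrow> real" where
  "thinning P t C 0 x = 1"
| "thinning P t C (Suc k) x =
     uprod (\<lambda>y. 1 - thinning P t C k y * of_bool (C x y)) {y \<in> P. t y < t x}"

text \<open>
  Solutions are indicator functions on the configuration; extensionality outside it makes
  uniqueness a meaningful requirement for a total function.
\<close>

definition thinning_inf ::
    "'a set \<Rightarrow> ('a \<Rightarrow> real) \<Rightarrow> ('a \<Rightarrow> 'a \<Rightarrow> bool) \<Rightarrow> 'a \<Rightarrow> real" where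
  "thinning_inf P t C =
     (THE e. e \<in> P \<rightarrow>\<^sub>E {0, 1} \<and>
        (\<forall>x\<in>P. e x = uprod (\<lambda>y. 1 - e y * of_bool (C x y)) {y \<in> P. t y < t x}))"


section \<open>Point processes with timers and contention variables\<close>

definition count_algebra :: "'w measure \<Rightarrow> ('w \<Rightarrow> 'a::euclidean_space set) \<Rightarrow> 'w measure" where
  "count_algebra M \<Phi> = sigma (space M)
     {{\<omega> \<in> space M. card (\<Phi> \<omega> \<inter> B) = n} | B n. B \<in> sets borel \<and> bounded B}"

locale point_process = prob_space M
  for M :: "'w measure" +
  fixes \<Phi> :: "'w \<Rightarrow> 'a::euclidean_space set"
  assumes locally_finite: "\<omega> \<in> space M \<Longrightarrow> bounded B \<Longrightarrow> finite (\<Phi> \<omega> \<inter> B)"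
    and measurable_counts: "sets (count_algebra M \<Phi>) \<subseteq> sets M"

text \<open>
  An enumeration determined by the process: the points are \<open>X 0, X 1, \<dots>\<close>, where the total number
  \<open>N\<close> of points may be infinite.  The values of \<open>X i\<close> for \<open>i \<ge> N\<close> are irrelevant.
\<close>

definition measurable_enumeration ::
    "'w measure \<Rightarrow> ('w \<Rightarrow> 'a::euclidean_space set) \<Rightarrow> ('w \<Rightarrow> enat) \<Rightarrow> (nat \<Rightarrow> 'w \<Rightarrow> 'a) \<Rightarrow> bool" where
  "measurable_enumeration M \<Phi> N X \<longleftrightarrow>
     N \<in> count_algebra M \<Phi> \<rightarrow>\<^sub>M count_space UNIV \<and>
     (\<forall>i. X i \<in> count_algebra M \<Phi> \<rightarrow>\<^sub>M borel) \<and>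
     (\<forall>\<omega> \<in> space M. bij_betw (\<lambda>i. X i \<omega>) {i. enat i < N \<omega>} (\<Phi> \<omega>))"

text \<open>
  Given \<open>\<Phi>\<close>, the marks are i.i.d. with law \<open>D\<close>: on every event \<open>A\<close> determined by \<open>\<Phi>\<close>, the marks
  of the first \<open>n\<close> enumerated points, when there are that many, are independent with law \<open>D\<close>.
\<close>

definition iid_marks ::
    "'w measure \<Rightarrow> ('w \<Rightarrow> enat) \<Rightarrow> (nat \<Rightarrow> 'w \<Rightarrow> 'a) \<Rightarrow> 'w measure \<Rightarrow>
     real measure \<Rightarrow> ('w \<Rightarrow> 'a \<Rightarrow> real) \<Rightarrow> bool" where
  "iid_marks M N X F D t \<longleftrightarrow>
     (\<forall>i. \<forall>S \<in> sets borel. {\<omega> \<in> space M. enat i < N \<omega> \<and> t \<omega> (X i \<omega>) \<in> S} \<in> sets M) \<and>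
     (\<forall>A \<in> sets F. \<forall>n. \<forall>S \<in> {..<n} \<rightarrow> sets borel.
        measure M {\<omega> \<in> A. enat n \<le> N \<omega> \<and> (\<forall>i<n. t \<omega> (X i \<omega>) \<in> S i)} =
        measure M {\<omega> \<in> A. enat n \<le> N \<omega>} * (\<Prod>i<n. measure D (S i)))"

text \<open>
  Only the values of \<open>t \<omega>\<close> on \<open>\<Phi> \<omega>\<close> and of \<open>C \<omega>\<close> on pairs of distinct points of \<open>\<Phi> \<omega>\<close> matter.
  No joint law is imposed on the contention variables.
\<close>

locale contention_process = point_process M \<Phi>
  for M :: "'w measure" and \<Phi> :: "'w \<Rightarrow> 'a::euclidean_space set" +
  fixes t :: "'w \<Rightarrow> 'a \<Rightarrow> real"
    and C :: "'w \<Rightarrow> 'a \<Rightarrow> 'a \<Rightarrow> bool"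
  assumes timer_range: "\<omega> \<in> space M \<Longrightarrow> x \<in> \<Phi> \<omega> \<Longrightarrow> t \<omega> x \<in> {0..1}"
    and contention_sym:
      "\<omega> \<in> space M \<Longrightarrow> x \<in> \<Phi> \<omega> \<Longrightarrow> y \<in> \<Phi> \<omega> \<Longrightarrow> x \<noteq> y \<Longrightarrow> C \<omega> x y = C \<omega> y x"
    and marks: "\<exists>N X. measurable_enumeration M \<Phi> N X \<and>
      iid_marks M N X (count_algebra M \<Phi>) (uniform_measure lborel {0..1}) t \<and>
      (\<forall>i j. i \<noteq> j \<longrightarrow>
        {\<omega> \<in> space M. enat i < N \<omega> \<and> enat j < N \<omega> \<and> C \<omega> (X i \<omega>) (X j \<omega>)} \<in> sets M)"

end

theory Submission
  imports Defs
begin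

text \<open>
  The statement is deterministic for each configuration.  If all reachable sets are finite, the
  number of vertices reachable from \<open>x\<close> drops strictly along every arc, because \<open>x\<close> itself is lost:
  timers decrease along paths.  Induction on this number \<open>m x\<close> shows that \<open>e\<^sub>k x\<close> does not depend on
  \<open>k \<ge> m x\<close>, that the eventual values solve the recursion, and that the recursion has at most one
  solution.
\<close>

text \<open>No convergence is assumed: the nets of finite subproducts agree on all finite subsets of
  \<open>A\<close>, so they have the same limits, and \<open>Lim\<close> is a definite description
  depending only on these.\<close>

lemma uprod_cong:
  assumes "\<And>y. y \<in> A \<Longrightarrow> f y = g y"
  shows "uprod f A = uprod g A"
proof -
  have "\<forall>\<^sub>F F in finite_subsets_at_top A. prod f F = prod g F"
    by (intro eventually_finite_subsets_at_top_weakI prod.cong) (use assms in auto)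
  from tendsto_cong[OF this] show ?thesis
    unfolding uprod_def Topological_Spaces.Lim_def by (simp only:)
qed

lemma thinning_zero_one: "thinning P t C k x \<in> {0, 1}"
proof (induction k arbitrary: x)
  case (Suc k)
  have "1 - thinning P t C k y * of_bool (C x y) \<in> {0, 1}" for y
    using Suc[of y] by auto
  then have "thinning P t C (Suc k) x =
      of_bool (\<forall>y\<in>{y \<in> P. t y < t x}. 1 - thinning P t C k y * of_bool (C x y) = 1)"
    unfolding thinning.simps by (intro uprod_zero_one)
  then show ?case by (simp only: of_bool_def split: if_split) blast
qed simp

locale non_percolating =
  fixes P :: "'a set" and t :: "'a \<Rightarrow> real" and C :: "'a \<Rightarrow> 'a \<Rightarrow> bool"
  assumes no_percolation: "no_infinite_positive_percolation (conflict_graph P t C)"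
begin

sublocale pair_wf_digraph "conflict_graph P t C"
  by unfold_locales (auto simp: conflict_graph_def)

lemma pverts_conflict_graph: "pverts (conflict_graph P t C) = P"
  by (simp add: conflict_graph_def)

lemma parcs_conflict_graph_iff:
  "(x, y) \<in> parcs (conflict_graph P t C) \<longleftrightarrow> x \<in> P \<and> y \<in> P \<and> C x y \<and> t y < t x"
  by (simp add: conflict_graph_def)

definition reach :: "'a \<Rightarrow> 'a set" where
  "reach x = {y. x \<rightarrow>\<^sup>*\<^bsub>conflict_graph P t C\<^esub> y}"

lemma finite_reach: "x \<in> P \<Longrightarrow> finite (reach x)"
  using no_percolation
  by (auto simp: no_infinite_positive_percolation_def reach_def pverts_conflict_graph)

text \<open>Reachability is reflexive only at vertices, hence the premise.\<close>

lemma self_in_reach: "x \<in> P \<Longrightarrow> x \<in> reach x"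
  by (simp add: reach_def pverts_conflict_graph)

lemma reach_timer_le: "y \<in> reach x \<Longrightarrow> t y \<le> t x"
proof -
  assume "y \<in> reach x"
  then have "x \<rightarrow>\<^sup>*\<^bsub>conflict_graph P t C\<^esub> y" by (simp add: reach_def)
  then show ?thesis
    by (induction rule: reachable_induct) (auto simp: parcs_conflict_graph_iff)
qed

lemma card_reach_less:
  assumes "x \<in> P" "y \<in> P" "C x y" "t y < t x"
  shows "card (reach y) < card (reach x)"
proof (rule psubset_card_mono[OF finite_reach[OF assms(1)]])
  have "x \<rightarrow>\<^bsub>conflict_graph P t C\<^esub> y"
    using assms by (simp add: parcs_conflict_graph_iff)
  then have "reach y \<subseteq> reach x"
    unfolding reach_def by (auto intro: adj_reachable_trans)
  moreover have "x \<in> reach x"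
    using assms(1) by (rule self_in_reach)
  \<comment> \<open>A path from \<open>y\<close> back to \<open>x\<close> would force
    \<open>t x \<le> t y\<close>.\<close>
  moreover have "x \<notin> reach y"
    using assms reach_timer_le[of x y] by auto
  ultimately show "reach y \<subset> reach x" by blast
qed

lemma reach_induct [consumes 1]:
  assumes "x \<in> P"
    and "\<And>x. x \<in> P \<Longrightarrow> (\<And>y. y \<in> P \<Longrightarrow> C x y \<Longrightarrow> t y < t x \<Longrightarrow> Q y) \<Longrightarrow> Q x"
  shows "Q x"
  using assms(1)
proof (induction "card (reach x)" arbitrary: x rule: less_induct)
  case less
  show ?case
    using less card_reach_less by (intro assms(2)[OF less.prems]) simp
qed

lemma thinning_stable:
  assumes "x \<in> P" "card (reach x) \<le> k" "card (reach x) \<le> l"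
  shows "thinning P t C k x = thinning P t C l x"
  using assms
proof (induction arbitrary: k l rule: reach_induct)
  case (1 x)
  \<comment> \<open>Positivity makes both stages successors, so the recursion unfolds and the start
    value 1 of stage 0 is not involved.\<close>
  have "0 < card (reach x)"
    using self_in_reach[of x] finite_reach[of x] 1(1) by (auto simp: card_gt_0_iff)
  then obtain k' l' where kl: "k = Suc k'" "l = Suc l'"
    using 1(3,4) by (metis gr0_conv_Suc less_le_trans)
  \<comment> \<open>Points without \<open>C x y\<close> contribute the factor 1 on both sides. For
    the others the strict drop in cardinality makes up for passing from \<open>k\<close>,
    \<open>l\<close> to \<open>k'\<close>, \<open>l'\<close>.\<close>
  have "thinning P t C k' y = thinning P t C l' y" if "y \<in> P" "t y < t x" "C x y" for y
    using card_reach_less[OF \<open>x \<in> P\<close> that(1,3,2)] that 1(3,4) kl by (intro "1.IH") simp_all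
  then show ?case
    unfolding kl thinning.simps by (intro uprod_cong) auto
qed

definition solves :: "('a \<Rightarrow> real) \<Rightarrow> bool" where
  "solves e \<longleftrightarrow> (\<forall>x\<in>P. e x = uprod (\<lambda>y. 1 - e y * of_bool (C x y)) {y \<in> P. t y < t x})"

lemma solves_unique:
  assumes "solves e" "solves e'" "x \<in> P"
  shows "e x = e' x"
  using assms(3)
proof (induction rule: reach_induct)
  case (1 x)
  then have "uprod (\<lambda>y. 1 - e y * of_bool (C x y)) {y \<in> P. t y < t x} =
      uprod (\<lambda>y. 1 - e' y * of_bool (C x y)) {y \<in> P. t y < t x}"
    by (intro uprod_cong) auto
  with \<open>x \<in> P\<close> assms(1,2) show ?case by (simp add: solves_def)
qed

text \<open>The stage varies with the point: from \<open>card (reach x)\<close> on, the sequence at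
  \<open>x\<close> is constant. Restriction to \<open>P\<close> provides the extensionality required
  by \<open>thinning_inf\<close>.\<close>

definition eventual_thinning :: "'a \<Rightarrow> real" where
  "eventual_thinning = (\<lambda>x\<in>P. thinning P t C (card (reach x)) x)"

lemma thinning_eq_eventual:
  "x \<in> P \<Longrightarrow> card (reach x) \<le> k \<Longrightarrow> thinning P t C k x = eventual_thinning x"
  using thinning_stable[of x k "card (reach x)"] by (simp add: eventual_thinning_def)

lemma solves_eventual_thinning: "solves eventual_thinning"
  unfolding solves_def
proof
  fix x assume x: "x \<in> P"
  have stable: "thinning P t C (card (reach x)) y = eventual_thinning y"
    if "y \<in> P" "t y < t x" "C x y" for y
    using card_reach_less[OF x that(1,3,2)] that(1) by (intro thinning_eq_eventual) simp_all
  \<comment> \<open>One extra stage is harmless at \<open>x\<close>, and after unfolding it leaves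
    the same stage \<open>card (reach x)\<close> in every factor, late enough for all
    out-neighbours. So no limit has to be moved through the infinite product.\<close>
  have "eventual_thinning x = thinning P t C (Suc (card (reach x))) x"
    by (rule thinning_eq_eventual[OF x, symmetric]) simp
  also have "\<dots> = uprod (\<lambda>y. 1 - eventual_thinning y * of_bool (C x y)) {y \<in> P. t y < t x}"
    unfolding thinning.simps by (intro uprod_cong) (use stable in simp)
  finally show "eventual_thinning x =
      uprod (\<lambda>y. 1 - eventual_thinning y * of_bool (C x y)) {y \<in> P. t y < t x}" .
qed

lemma thinning_inf_eq: "thinning_inf P t C = eventual_thinning"
  unfolding thinning_inf_def solves_def[symmetric]
proof (rule the_equality)
  have "eventual_thinning \<in> P \<rightarrow>\<^sub>E {0, 1}"
    unfolding eventual_thinning_def by (intro restrict_PiE_iff[THEN iffD2] ballI thinning_zero_one)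
  then show "eventual_thinning \<in> P \<rightarrow>\<^sub>E {0, 1} \<and> solves eventual_thinning"
    using solves_eventual_thinning by simp
next
  fix e assume "e \<in> P \<rightarrow>\<^sub>E {0, 1} \<and> solves e"
  then show "e = eventual_thinning"
    \<comment> \<open>Both functions are \<open>undefined\<close> off \<open>P\<close>, so agreement
      on \<open>P\<close> suffices.\<close>
    using solves_unique[OF _ solves_eventual_thinning]
    by (intro extensionalityI[of e P]) (auto simp: PiE_def eventual_thinning_def)
qed

lemma thinning_tendsto:
  assumes "x \<in> P"
  shows "(\<lambda>k. thinning P t C k x) \<longlonglongrightarrow> thinning_inf P t C x"
proof (rule tendsto_eventually)
  show "\<forall>\<^sub>F k in sequentially. thinning P t C k x = thinning_inf P t C x"
    using thinning_eq_eventual[OF assms]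
    by (auto simp: thinning_inf_eq eventually_sequentially)
qed

end

theorem proposition4:
  fixes M :: "'w measure"
    and \<Phi> :: "'w \<Rightarrow> (real^2) set"
    and t :: "'w \<Rightarrow> real^2 \<Rightarrow> real"
    and C :: "'w \<Rightarrow> real^2 \<Rightarrow> real^2 \<Rightarrow> bool"
  assumes "contention_process M \<Phi> t C"
    and "AE \<omega> in M. no_infinite_positive_percolation (conflict_graph (\<Phi> \<omega>) (t \<omega>) (C \<omega>))"
  shows "AE \<omega> in M. \<forall>x \<in> \<Phi> \<omega>.
    (\<lambda>k. thinning (\<Phi> \<omega>) (t \<omega>) (C \<omega>) k x) \<longlonglongrightarrow> thinning_inf (\<Phi> \<omega>) (t \<omega>) (C \<omega>) x"
  \<comment> \<open>The deterministic result applies at each outcome without percolation, so a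
    single null set serves all points at once.\<close>
  using assms(2)
  by (rule eventually_mono) (simp add: non_percolating.thinning_tendsto non_percolating.intro)

end
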